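(* For $1\le R\le 10/9$, the following algorithm is $\frac{1+\sqrt{1+4R}}{2R}$-competitive for the proportional\&removable online knapsack problem with a buffer of capacity $R$. Let $r=\frac{\sqrt{1+4R}-1}{2}$ (so $r+r^2=R$). Call an item $e$ small if $s(e)\le r^2$, medium if $r^2<s(e)<r$, large if $s(e)\ge r$; let $M$ be the set of medium items. Start with $B_0=\emptyset$. In round $i$: if there exists $B'\subseteq B_{i-1}\cup\{e_i\}$ with $r\le s(B')\le 1$, set $B_i=B'$ for such a $B'$. Otherwise, if $e_i\in M$ and $|B_{i-1}\cap M|=1$, let $B_{i-1}\cap M=\{e_i'\}$; if $s(e_i)<s(e_i')$ set $B_i=(B_{i-1}\cup\{e_i\})\setminus\{e_i'\}$, else set $B_i=B_{i-1}$. Otherwise, set $B_i=\emptyset$ and go through the items $e\in B_{i-1}\cup\{e_i\}$ in non-increasing order of size, adding $e$ to $B_i$ whenever $s(B_i)+s(e)\le R$.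
   Context: Online knapsack problem with a resource buffer: there is a knapsack of capacity $1$ and a buffer of capacity $R\ge 1$. Items $e_1,\dots,e_n$ arrive one by one; each item $e$ has size $0<s(e)\le 1$ and value $v(e)\ge 0$; $s(B),v(B)$ denote sums over a set $B$. A deterministic online algorithm maintains buffer contents $B_0=\emptyset,B_1,\dots,B_n$, with $B_i$ chosen after seeing only $e_1,\dots,e_i$, $B_i\subseteq B_{i-1}\cup\{e_i\}$ and $s(B_i)\le R$ (removable setting). $\mathrm{ALG}(I)=\max\{v(B)\mid B\subseteq B_n,\ s(B)\le 1\}$, $\mathrm{OPT}(I)=\max\{v(B)\mid B\subseteq\{e_1,\dots,e_n\},\ s(B)\le 1\}$. "Proportional" means $v(e)=s(e)$ for every item. An algorithm is $c$-competitive if $\mathrm{OPT}(I)\le c\cdot\mathrm{ALG}(I)$ for every input $I$. Ties are broken arbitrarily. *)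

theory Defs
  imports Complex_Main
begin

datatype item = Item (item_size: real) (item_value: real)

text \<open>
  An input is the list of items in order of arrival. Different items may have equal size and
  value, so an item is identified by its position in the list, and sets of items are sets of
  positions.
\<close>

definition total_size :: "item list \<Rightarrow> nat set \<Rightarrow> real" where
  "total_size I B = (\<Sum>i\<in>B. item_size (I ! i))"

definition total_value :: "item list \<Rightarrow> nat set \<Rightarrow> real" where
  "total_value I B = (\<Sum>i\<in>B. item_value (I ! i))"

definition inputs :: "item list set" where
  "inputs = {I. \<forall>e\<in>set I. 0 < item_size e \<and> item_size e \<le> 1 \<and> 0 \<le> item_value e}"

definition proportional_inputs :: "item list set" where
  "proportional_inputs = {I \<in> inputs. \<forall>e\<in>set I. item_value e = item_size e}"

definition knapsack_value :: "item list \<Rightarrow> nat set \<Rightarrow> real" where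
  "knapsack_value I S = Max {total_value I B | B. B \<subseteq> S \<and> total_size I B \<le> 1}"

definition OPT :: "item list \<Rightarrow> real" where
  "OPT I = knapsack_value I {..<length I}"

text \<open>
  A deterministic online algorithm is a function assigning to the sequence of items seen so far
  the current buffer contents, so that the buffers on input \<open>I\<close> are
  \<open>A (take 0 I), A (take 1 I), \<dots>, A I\<close>. Only its behaviour on the admissible inputs \<open>P\<close> matters;
  \<open>P\<close> is meant to be closed under prefixes.
\<close>

definition ALG :: "(item list \<Rightarrow> nat set) \<Rightarrow> item list \<Rightarrow> real" where
  "ALG A I = knapsack_value I (A I)"

definition removable_online_algorithm ::
    "item list set \<Rightarrow> real \<Rightarrow> (item list \<Rightarrow> nat set) \<Rightarrow> bool" where
  "removable_online_algorithm P R A \<longleftrightarrow>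
     A [] = {} \<and>
     (\<forall>I e. I @ [e] \<in> P \<longrightarrow>
        A (I @ [e]) \<subseteq> A I \<union> {length I} \<and> total_size (I @ [e]) (A (I @ [e])) \<le> R)"

definition competitive :: "item list set \<Rightarrow> real \<Rightarrow> (item list \<Rightarrow> nat set) \<Rightarrow> bool" where
  "competitive P c A \<longleftrightarrow> (\<forall>I\<in>P. OPT I \<le> c * ALG A I)"

definition threshold :: "real \<Rightarrow> real" where
  "threshold R = (sqrt (1 + 4 * R) - 1) / 2"

definition medium :: "real \<Rightarrow> item list \<Rightarrow> nat set" where
  "medium R I = {i. i < length I \<and>
     (threshold R)\<^sup>2 < item_size (I ! i) \<and> item_size (I ! i) < threshold R}"

definition greedy :: "real \<Rightarrow> item list \<Rightarrow> nat list \<Rightarrow> nat set" where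
  "greedy R I xs =
     foldl (\<lambda>B i. if total_size I B + item_size (I ! i) \<le> R then insert i B else B) {} xs"

text \<open>
  One round of the algorithm, where \<open>I\<close> is the sequence of items seen so far, \<open>i\<close> the position
  of the newly arrived one, and \<open>B\<close>, \<open>B'\<close> the buffers before and after the round. It is a
  relation, because the choice of the set in the first case and the order of items of equal size
  in the last case are left open.
\<close>

definition buffer_step :: "real \<Rightarrow> item list \<Rightarrow> nat \<Rightarrow> nat set \<Rightarrow> nat set \<Rightarrow> bool" where
  "buffer_step R I i B B' \<longleftrightarrow>
     (let good = (\<lambda>C. C \<subseteq> B \<union> {i} \<and> threshold R \<le> total_size I C \<and> total_size I C \<le> 1);
          M = medium R I
      in if \<exists>C. good C then good B'
         else if i \<in> M \<and> card (B \<inter> M) = 1 then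
           (\<exists>j. B \<inter> M = {j} \<and>
              B' = (if item_size (I ! i) < item_size (I ! j) then (B \<union> {i}) - {j} else B))
         else
           (\<exists>xs. distinct xs \<and> set xs = B \<union> {i} \<and>
              sorted_wrt (\<lambda>a b. item_size (I ! b) \<le> item_size (I ! a)) xs \<and>
              B' = greedy R I xs))"

text \<open>
  \<open>A\<close> is an instance of the algorithm if each of its rounds is a legal one. The open choices may
  thus be resolved differently in every round, depending on everything seen so far.
\<close>

definition buffer_algorithm :: "real \<Rightarrow> (item list \<Rightarrow> nat set) \<Rightarrow> bool" where
  "buffer_algorithm R A \<longleftrightarrow>
     A [] = {} \<and>
     (\<forall>I e. I @ [e] \<in> proportional_inputs \<longrightarrow>
        buffer_step R (I @ [e]) (length I) (A I) (A (I @ [e])))"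

lemma buffer_step_exists:
  assumes "finite B"
  shows "\<exists>B'. finite B' \<and> buffer_step R I i B B'"
proof -
  define good where
    "good = (\<lambda>C. C \<subseteq> B \<union> {i} \<and> threshold R \<le> total_size I C \<and> total_size I C \<le> 1)"
  define M where "M = medium R I"
  have step: "buffer_step R I i B B' \<longleftrightarrow>
      (if \<exists>C. good C then good B'
       else if i \<in> M \<and> card (B \<inter> M) = 1 then
         (\<exists>j. B \<inter> M = {j} \<and>
            B' = (if item_size (I ! i) < item_size (I ! j) then (B \<union> {i}) - {j} else B))
       else
         (\<exists>xs. distinct xs \<and> set xs = B \<union> {i} \<and>
            sorted_wrt (\<lambda>a b. item_size (I ! b) \<le> item_size (I ! a)) xs \<and>
            B' = greedy R I xs))" for B'
    unfolding buffer_step_def Let_def good_def M_def ..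
  consider (good) C where "good C"
    | (medium) "\<nexists>C. good C" "i \<in> M \<and> card (B \<inter> M) = 1"
    | (greedy) "\<nexists>C. good C" "\<not> (i \<in> M \<and> card (B \<inter> M) = 1)"
    by blast
  then show ?thesis
  proof cases
    case good
    then have "finite C"
      using assms by (auto simp: good_def intro: finite_subset)
    with good show ?thesis
      unfolding step by auto
  next
    case medium
    then obtain j where j: "B \<inter> M = {j}"
      by (auto simp: card_1_singleton_iff)
    show ?thesis
      by (rule exI[of _ "if item_size (I ! i) < item_size (I ! j) then (B \<union> {i}) - {j} else B"])
         (use medium j assms in \<open>auto simp: step\<close>)
  next
    case greedy
    define xs where "xs = sort_key (\<lambda>a. - item_size (I ! a)) (sorted_list_of_set (B \<union> {i}))"
    have "distinct xs" "set xs = B \<union> {i}"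
      using assms by (simp_all add: xs_def del: sorted_list_of_set_insert_remove)
    moreover have "sorted_wrt (\<lambda>a b. item_size (I ! b) \<le> item_size (I ! a)) xs"
      using sorted_sort_key[of "\<lambda>a. - item_size (I ! a)" "sorted_list_of_set (B \<union> {i})"]
      by (simp add: xs_def sorted_map)
    ultimately have "buffer_step R I i B (greedy R I xs)"
      using greedy unfolding step by auto
    moreover have "finite (greedy R I ys)" for ys
      by (induction ys rule: rev_induct) (auto simp: greedy_def)
    ultimately show ?thesis
      by blast
  qed
qed

lemma buffer_algorithm_exists: "\<exists>A. buffer_algorithm R A"
proof -
  define next_buffer where
    "next_buffer = (\<lambda>I i B. SOME B'. finite B' \<and> buffer_step R I i B B')"
  define A where
    "A = (\<lambda>I. rec_list {} (\<lambda>e J B. next_buffer (rev (e # J)) (length J) B) (rev I))"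
  have next_buffer: "finite (next_buffer I i B) \<and> buffer_step R I i B (next_buffer I i B)"
    if "finite B" for I i B
    unfolding next_buffer_def by (rule someI_ex) (rule buffer_step_exists[OF that])
  have A_snoc: "A (I @ [e]) = next_buffer (I @ [e]) (length I) (A I)" for I e
    by (simp add: A_def)
  have "finite (A I)" for I
    by (induction I rule: rev_induct) (simp_all add: A_snoc next_buffer, simp add: A_def)
  then have "buffer_algorithm R A"
    using next_buffer by (auto simp: buffer_algorithm_def A_snoc) (simp add: A_def)
  then show ?thesis
    by blast
qed

end

theory Submission
  imports Defs
begin

text \<open>
  With \<open>r = threshold R\<close> the ratio is \<open>1 / r\<close>, so a buffer with a subset of size in \<open>[r, 1]\<close> suffices,
  and such a subset survives once it exists. As long as there is none, the buffer consists of all small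
  items and one smallest medium item, and it never overflows: two items of size in \<open>(1 - r, r\<^sup>2]\<close> would
  have total size in \<open>[r, 1]\<close> (here \<open>r \<le> 2/3\<close>, i.e. \<open>R \<le> 10/9\<close>, is used), so there is at most one of
  them, and the rest of the buffer has size below \<open>r\<close>. Any two medium items have total size above 1,
  so an optimal solution contains at most one medium item \<open>x\<close>; replacing it by the smallest medium
  item \<open>m\<close> costs at most a factor \<open>r\<close>, as \<open>r x < r\<^sup>2 < m\<close>.
\<close>

section \<open>Sets none of whose subsets has size in [r, 1]\<close>

text \<open>Extend \<open>E\<close> by one element at a time. A sum below \<open>r\<close> grows by
  at most \<open>1 - r\<close>, so it stays at most 1, and the gap forces it below \<open>r\<close>
  again: steps this short cannot jump over [r, 1].\<close>

lemma sum_below_if_fine: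
  fixes f :: "'a \<Rightarrow> real"
  assumes "finite B" and "E \<subseteq> B" and "sum f E < r"
    and gap: "\<And>C. C \<subseteq> B \<Longrightarrow> \<not> (r \<le> sum f C \<and> sum f C \<le> 1)"
    and fine: "\<And>x. x \<in> B - E \<Longrightarrow> f x \<le> 1 - r"
  shows "sum f B < r"
proof -
  have "finite (B - E)"
    using assms(1) by simp
  have "F \<subseteq> B - E \<Longrightarrow> sum f (E \<union> F) < r" if "finite F" for F
    using that
  proof (induction F rule: finite_induct)
    case empty
    then show ?case using assms(3) by simp
  next
    case (insert x F)
    have "finite (E \<union> F)"
      using insert assms(1,2) finite_subset by blast
    then have "sum f (E \<union> insert x F) = f x + sum f (E \<union> F)"
      using insert by (subst Un_insert_right, subst sum.insert) auto
    also have "\<dots> \<le> 1"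
      using insert fine[of x] by auto
    finally show ?case
      using gap[of "E \<union> insert x F"] insert.prems assms(2) by force
  qed
  from this[of "B - E"] show ?thesis
    using \<open>finite (B - E)\<close> assms(2) by (simp add: Un_absorb1)
qed

text \<open>The only element too big for such a step, if there is one, serves as the starting set
  \<open>E\<close>; by itself it is below \<open>r\<close>.\<close>

lemma sum_below_if_one_coarse:
  fixes f :: "'a \<Rightarrow> real"
  assumes "finite B" and "0 < r"
    and gap: "\<And>C. C \<subseteq> B \<Longrightarrow> \<not> (r \<le> sum f C \<and> sum f C \<le> 1)"
    and below: "\<And>x. x \<in> B \<Longrightarrow> f x < r"
    and one: "\<And>x y. x \<in> B \<Longrightarrow> y \<in> B \<Longrightarrow> 1 - r < f x \<Longrightarrow> 1 - r < f y \<Longrightarrow> x = y"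
  shows "sum f B < r"
proof (cases "\<exists>x\<in>B. 1 - r < f x")
  case True
  then obtain x where "x \<in> B" "1 - r < f x"
    by blast
  show ?thesis
  proof (rule sum_below_if_fine[OF assms(1)])
    show "{x} \<subseteq> B" and "sum f {x} < r"
      using \<open>x \<in> B\<close> below by simp_all
    show "f y \<le> 1 - r" if "y \<in> B - {x}" for y
      using that one[OF \<open>x \<in> B\<close> _ \<open>1 - r < f x\<close>, of y] by fastforce
  qed (rule gap)
next
  case False
  show ?thesis
  proof (rule sum_below_if_fine[OF assms(1)])
    show "{} \<subseteq> B" and "sum f {} < r"
      using assms(2) by simp_all
    show "f y \<le> 1 - r" if "y \<in> B - {}" for y
      using that False by (simp add: not_less)
  qed (rule gap)
qed

text \<open>At most one element lies in (1 - r, r^2] and at most one above r^2. Once the former is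
  set aside, at most one element exceeds \<open>1 - r\<close>, so the rest sums to less than
  \<open>r\<close>; the element set aside adds at most r^2.\<close>

lemma sum_le_capacity:
  fixes f :: "'a \<Rightarrow> real"
  assumes "finite B" and r: "1 - r \<le> r\<^sup>2" "1 / 2 \<le> r" "r \<le> 2 / 3"
    and gap: "\<And>C. C \<subseteq> B \<Longrightarrow> \<not> (r \<le> sum f C \<and> sum f C \<le> 1)"
    and below: "\<And>x. x \<in> B \<Longrightarrow> f x < r"
    and one_medium: "\<And>x y. x \<in> B \<Longrightarrow> y \<in> B \<Longrightarrow> r\<^sup>2 < f x \<Longrightarrow> r\<^sup>2 < f y \<Longrightarrow> x = y"
  shows "sum f B \<le> r + r\<^sup>2"
proof -
  have sq: "r\<^sup>2 \<le> 1 / 2"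
    using r(2,3) mult_mono[of r "2/3" r "2/3"] by (simp add: power2_eq_square)
  \<comment> \<open>Two distinct such elements would sum to more than 2 (1 - r), which is at least r
    because r <= 2/3, and to at most 2 r^2 <= 1, contradicting the gap.\<close>
  have one_small: "x = y"
    if "x \<in> B" "y \<in> B" "1 - r < f x" "f x \<le> r\<^sup>2" "1 - r < f y" "f y \<le> r\<^sup>2" for x y
  proof (rule ccontr)
    assume "x \<noteq> y"
    then have "sum f {x, y} = f x + f y"
      by simp
    then show False
      using gap[of "{x, y}"] that r sq by auto
  qed
  show ?thesis
  proof (cases "\<exists>t\<in>B. 1 - r < f t \<and> f t \<le> r\<^sup>2")
    case True
    then obtain t where t: "t \<in> B" "1 - r < f t" "f t \<le> r\<^sup>2"
      by blast
    have "sum f (B - {t}) < r"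
    proof (rule sum_below_if_one_coarse)
      show "x = y" if "x \<in> B - {t}" "y \<in> B - {t}" "1 - r < f x" "1 - r < f y" for x y
        using that one_small[OF t(1), of x] one_small[OF t(1), of y] one_medium[of x y] t
        by fastforce
    qed (use assms(1) r gap below in auto)
    then show ?thesis
      using t assms(1) sum.remove[of B t f] by linarith
  next
    case False
    have "sum f B < r"
    proof (rule sum_below_if_one_coarse)
      show "x = y" if "x \<in> B" "y \<in> B" "1 - r < f x" "1 - r < f y" for x y
        using that False one_medium[of x y] by force
    qed (use assms(1) r gap below in auto)
    then show ?thesis
      using zero_le_power2[of r] by linarith
  qed
qed

section \<open>The threshold and the ratio\<close>

text \<open>\<open>threshold R\<close> is the positive root of r + r^2 = R, and 2/3 is its value at
  R = 10/9. The bound 1/2 is crude but suffices for r <= 2 r^2. With s =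
  \<open>sqrt (1 + 4 * R)\<close>, the identity (s + 1) (s - 1) = 4 R turns the ratio into 1 /
  r.\<close>

lemma threshold_bounds:
  assumes "1 \<le> R" and "R \<le> 10 / 9"
  shows "threshold R + (threshold R)\<^sup>2 = R" and "1 / 2 \<le> threshold R" and "threshold R \<le> 2 / 3"
    and "(1 + sqrt (1 + 4 * R)) / (2 * R) = 1 / threshold R"
proof -
  define s where "s = sqrt (1 + 4 * R)"
  have r: "threshold R = (s - 1) / 2"
    by (simp add: threshold_def s_def)
  have s2: "s\<^sup>2 = 1 + 4 * R"
    using assms by (simp add: s_def)
  have "s \<ge> 2"
    unfolding s_def by (rule real_le_rsqrt) (use assms in simp)
  have "s \<le> 7 / 3"
    unfolding s_def by (rule real_le_lsqrt) (use assms in \<open>simp_all add: power2_eq_square\<close>)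
  show "threshold R + (threshold R)\<^sup>2 = R"
    using s2 by (simp add: r power2_eq_square field_simps)
  show "1 / 2 \<le> threshold R" "threshold R \<le> 2 / 3"
    using \<open>s \<ge> 2\<close> \<open>s \<le> 7 / 3\<close> by (simp_all add: r)
  have "(1 + s) * (s - 1) = 4 * R"
    using s2 by (simp add: power2_eq_square algebra_simps)
  then show "(1 + sqrt (1 + 4 * R)) / (2 * R) = 1 / threshold R"
    using assms \<open>s \<ge> 2\<close> unfolding r s_def[symmetric] by (simp add: field_simps)
qed

section \<open>Greedy filling, sizes and knapsack values\<close>

lemma greedy_subset: "greedy R I xs \<subseteq> set xs"
  by (induction xs rule: rev_induct) (auto simp: greedy_def)

text \<open>Sizes are nonnegative, so every prefix fits if the whole list does, and no item is ever
  rejected.\<close>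

lemma greedy_eq_set:
  assumes "distinct xs" and "\<And>i. i \<in> set xs \<Longrightarrow> 0 \<le> item_size (I ! i)"
    and "total_size I (set xs) \<le> R"
  shows "greedy R I xs = set xs"
  using assms
proof (induction xs rule: rev_induct)
  case Nil
  then show ?case by (simp add: greedy_def)
next
  case (snoc x xs)
  have *: "total_size I (set (xs @ [x])) = total_size I (set xs) + item_size (I ! x)"
    using snoc.prems(1) by (simp add: total_size_def)
  moreover have "0 \<le> item_size (I ! x)"
    using snoc.prems(2) by simp
  ultimately have "total_size I (set xs) \<le> R"
    using snoc.prems(3) by linarith
  then have "greedy R I xs = set xs"
    using snoc by simp
  then show ?case
    using snoc.prems(3) * by (simp add: greedy_def)
qed

lemma total_size_append:
  "C \<subseteq> {..<length I} \<Longrightarrow> total_size (I @ J) C = total_size I C"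
  unfolding total_size_def by (rule sum.cong) (auto simp: nth_append)

lemma total_value_proportional:
  assumes "I \<in> proportional_inputs" and "C \<subseteq> {..<length I}"
  shows "total_value I C = total_size I C"
  unfolding total_size_def total_value_def
  by (rule sum.cong) (use assms in \<open>auto simp: proportional_inputs_def\<close>)

lemma proportional_inputs_size_pos:
  "I \<in> proportional_inputs \<Longrightarrow> i < length I \<Longrightarrow> 0 < item_size (I ! i)"
  by (auto simp: proportional_inputs_def inputs_def)

lemma proportional_inputs_appendD:
  "I @ J \<in> proportional_inputs \<Longrightarrow> I \<in> proportional_inputs"
  by (auto simp: proportional_inputs_def inputs_def)

lemma knapsack_value_ge:
  assumes "finite S" and "C \<subseteq> S" and "total_size I C \<le> 1"
  shows "total_value I C \<le> knapsack_value I S"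
  unfolding knapsack_value_def
proof (rule Max_ge)
  show "finite {total_value I B |B. B \<subseteq> S \<and> total_size I B \<le> 1}"
    using assms(1) by simp
qed (use assms in auto)

lemma knapsack_value_attained:
  assumes "finite S"
  obtains C where "C \<subseteq> S" "total_size I C \<le> 1" "knapsack_value I S = total_value I C"
proof -
  have "{total_value I B |B. B \<subseteq> S \<and> total_size I B \<le> 1} \<noteq> {}"
    by (auto simp: total_size_def intro!: exI[of _ "{}"])
  then have "knapsack_value I S \<in> {total_value I B |B. B \<subseteq> S \<and> total_size I B \<le> 1}"
    unfolding knapsack_value_def using assms by (intro Max_in) auto
  then show ?thesis
    using that by blast
qed

section \<open>The invariant of the buffer\<close>

definition smalls :: "real \<Rightarrow> item list \<Rightarrow> nat set" where
  "smalls R I = {i. i < length I \<and> item_size (I ! i) \<le> (threshold R)\<^sup>2}"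

text \<open>The first case of \<open>buffer_step\<close> makes the new buffer itself such a set, so
  the invariant can demand this of the whole buffer instead of one of its subsets.\<close>

definition good_set :: "real \<Rightarrow> item list \<Rightarrow> nat set \<Rightarrow> bool" where
  "good_set R I C \<longleftrightarrow> threshold R \<le> total_size I C \<and> total_size I C \<le> 1"

text \<open>The state as long as the first case of \<open>buffer_step\<close> has never applied. The
  clauses on large and on medium items range over everything that has arrived, not only over the
  buffer, because an optimal solution may use discarded items.\<close>

definition stuck :: "real \<Rightarrow> item list \<Rightarrow> nat set \<Rightarrow> bool" where
  "stuck R I B \<longleftrightarrow>
     (\<forall>i<length I. item_size (I ! i) < threshold R) \<and>
     (\<forall>C\<subseteq>B. \<not> good_set R I C) \<and>
     (\<forall>k\<in>medium R I. \<forall>l\<in>medium R I. k \<noteq> l \<longrightarrow> 1 < item_size (I ! k) + item_size (I ! l)) \<and>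
     (medium R I = {} \<and> B = smalls R I \<or>
      (\<exists>j\<in>medium R I. B = insert j (smalls R I) \<and>
         (\<forall>k\<in>medium R I. item_size (I ! j) \<le> item_size (I ! k))))"

lemma medium_snoc:
  "medium R (I @ [e]) = medium R I \<union>
     (if (threshold R)\<^sup>2 < item_size e \<and> item_size e < threshold R then {length I} else {})"
  by (auto simp: medium_def nth_append less_Suc_eq)

lemma smalls_snoc:
  "smalls R (I @ [e]) = smalls R I \<union>
     (if item_size e \<le> (threshold R)\<^sup>2 then {length I} else {})"
  by (auto simp: smalls_def nth_append less_Suc_eq)

lemma stuck_subset: "stuck R I B \<Longrightarrow> B \<subseteq> {..<length I}"
  by (auto simp: stuck_def smalls_def medium_def)

lemma stuck_medium_unique:
  "stuck R I B \<Longrightarrow> x \<in> B \<Longrightarrow> y \<in> B \<Longrightarrow> x \<in> medium R I \<Longrightarrow> y \<in> medium R I \<Longrightarrow> x = y"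
  by (auto simp: stuck_def smalls_def medium_def)

text \<open>Instead of \<open>stuck\<close> only some of its consequences are assumed, so that the
  bound also covers \<open>B \<union> {length I}\<close> before the greedy pass is known to keep all
  of it.\<close>

lemma stuck_total_size_le:
  assumes "1 \<le> R" and "R \<le> 10 / 9" and "B \<subseteq> {..<length I}"
    and "\<And>i. i < length I \<Longrightarrow> item_size (I ! i) < threshold R"
    and "\<And>C. C \<subseteq> B \<Longrightarrow> \<not> good_set R I C"
    and "\<And>x y. x \<in> B \<Longrightarrow> y \<in> B \<Longrightarrow> x \<in> medium R I \<Longrightarrow> y \<in> medium R I \<Longrightarrow> x = y"
  shows "total_size I B \<le> R"
proof -
  note r = threshold_bounds[OF assms(1,2)]
  have "sum (\<lambda>i. item_size (I ! i)) B \<le> threshold R + (threshold R)\<^sup>2"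
  proof (rule sum_le_capacity)
    show "finite B"
      using assms(3) finite_subset by blast
    show "x = y" if "x \<in> B" "y \<in> B" "(threshold R)\<^sup>2 < item_size (I ! x)"
      "(threshold R)\<^sup>2 < item_size (I ! y)" for x y
      using that assms(3,4) assms(6)[of x y] by (auto simp: medium_def)
  qed (use assms(1,3,4) assms(5)[unfolded good_set_def total_size_def] r in auto)
  then show ?thesis
    using r(1) by (simp add: total_size_def)
qed

section \<open>Preservation of the invariant in one round\<close>

text \<open>If a new medium item meets a buffered one, the smaller of the two stays and is the
  minimum of all medium items so far. Otherwise buffer and new item together contain at most one
  medium item, hence fit into \<open>R\<close>, and the greedy pass drops nothing.\<close>

lemma stuck_step:
  assumes R: "1 \<le> R" "R \<le> 10 / 9"
    and I: "I @ [e] \<in> proportional_inputs"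
    and stuck: "stuck R I B"
    and step: "buffer_step R (I @ [e]) (length I) B B'"
    and no_good: "\<And>C. C \<subseteq> B \<union> {length I} \<Longrightarrow> \<not> good_set R (I @ [e]) C"
  shows "stuck R (I @ [e]) B' \<and> B' \<subseteq> B \<union> {length I}"
proof -
  note r = threshold_bounds[OF R]
  let ?I = "I @ [e]" and ?n = "length I"
  let ?M = "medium R ?I"
  have item: "item_size (?I ! i) = item_size (I ! i)" if "i < ?n" for i
    using that by (simp add: nth_append)
  have B: "B \<subseteq> {..<?n}"
    using stuck by (rule stuck_subset)
  have e: "item_size e \<le> 1" "0 < item_size e"
    using I by (auto simp: proportional_inputs_def inputs_def)
  \<comment> \<open>A large item would be a good set on its own.\<close>
  have e_lt: "item_size e < threshold R"
    using no_good[of "{?n}"] e by (auto simp: good_set_def total_size_def)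
  have below: "item_size (?I ! i) < threshold R" if "i < length ?I" for i
    using that stuck e_lt by (auto simp: stuck_def nth_append less_Suc_eq)
  have M_B: "B \<inter> ?M = B \<inter> medium R I"
    using B by (auto simp: medium_snoc)
  have new_medium: "?M = insert ?n (medium R I)" "smalls R ?I = smalls R I" if "?n \<in> ?M"
  proof -
    have "(threshold R)\<^sup>2 < item_size e" "item_size e < threshold R"
      using that by (simp_all add: medium_def)
    then show "?M = insert ?n (medium R I)" "smalls R ?I = smalls R I"
      by (simp_all add: medium_snoc smalls_snoc)
  qed
  \<comment> \<open>The item \<open>k\<close> may have been discarded, but the buffer holds a medium
    \<open>j\<close> that is no larger. The pair of \<open>j\<close> and the new item has size above
    2 r^2 >= r; as it is not good, its size exceeds 1.\<close>
  have two_medium: "1 < item_size (?I ! k) + item_size e"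
    if k: "k \<in> medium R I" and "?n \<in> ?M" for k
  proof -
    obtain j where j: "j \<in> medium R I" "j \<in> B" "item_size (I ! j) \<le> item_size (I ! k)"
      using stuck k by (auto simp: stuck_def)
    have "j < ?n" "k < ?n"
      using j k by (auto simp: medium_def)
    then have "total_size ?I {j, ?n} = item_size (I ! j) + item_size e"
      by (simp add: total_size_def item)
    moreover have "threshold R \<le> 2 * (threshold R)\<^sup>2"
      using r(2) mult_right_mono[of "1/2" "threshold R" "threshold R"]
      by (simp add: power2_eq_square)
    ultimately show ?thesis
      using no_good[of "{j, ?n}"] j \<open>k < ?n\<close> \<open>?n \<in> ?M\<close>
      by (auto simp: good_set_def medium_def nth_append)
  qed
  have pairs: "1 < item_size (?I ! k) + item_size (?I ! l)"
    if "k \<in> ?M" "l \<in> ?M" "k \<noteq> l" for k l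
  proof -
    have M': "x \<in> medium R I \<or> x = ?n" if "x \<in> ?M" for x
      using that by (auto simp: medium_snoc split: if_splits)
    have M_lt: "x < ?n" if "x \<in> medium R I" for x
      using that by (simp add: medium_def)
    show ?thesis
      using M'[OF that(1)] M'[OF that(2)]
    proof (elim disjE)
      assume "k \<in> medium R I" "l \<in> medium R I"
      then show ?thesis
        using stuck that(3) M_lt by (simp add: stuck_def item)
    next
      assume "k \<in> medium R I" "l = ?n"
      then show ?thesis
        using two_medium[of k] that(2) by simp
    next
      assume "k = ?n" "l \<in> medium R I"
      then show ?thesis
        using two_medium[of l] that(1) by simp
    qed (use that(3) in simp)
  qed
  have no_good_step: "\<not> (\<exists>C. C \<subseteq> B \<union> {?n} \<and> threshold R \<le> total_size ?I C \<and> total_size ?I C \<le> 1)"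
    using no_good by (auto simp: good_set_def)
  \<comment> \<open>All clauses of \<open>stuck\<close> except the shape of the buffer are now
    settled for every subset of \<open>B \<union> {?n}\<close>.\<close>
  have stuckI: "stuck R ?I B'"
    if "B' \<subseteq> B \<union> {?n}" and "?M = {} \<and> B' = smalls R ?I \<or>
      (\<exists>j\<in>?M. B' = insert j (smalls R ?I) \<and> (\<forall>k\<in>?M. item_size (?I ! j) \<le> item_size (?I ! k)))"
    unfolding stuck_def using that below pairs no_good by (meson subset_trans)
  have shape: "medium R I = {} \<and> B = smalls R I \<or>
      (\<exists>j\<in>medium R I. B = insert j (smalls R I) \<and>
         (\<forall>k\<in>medium R I. item_size (I ! j) \<le> item_size (I ! k)))"
    using stuck by (auto simp: stuck_def)
  have M_item: "item_size (?I ! k) = item_size (I ! k)" if "k \<in> medium R I" for k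
    using that by (auto simp: medium_def nth_append)
  show ?thesis
  proof (cases "?n \<in> ?M \<and> card (B \<inter> ?M) = 1")
    case True
    then obtain j where j: "B \<inter> ?M = {j}"
      and B': "B' = (if item_size (?I ! ?n) < item_size (?I ! j) then (B \<union> {?n}) - {j} else B)"
      using step True unfolding buffer_step_def Let_def if_not_P[OF no_good_step] if_P[OF True]
      by blast
    have M': "?M = insert ?n (medium R I)" and S': "smalls R ?I = smalls R I"
      using True new_medium by simp_all
    have "j \<in> B \<inter> medium R I"
      unfolding M_B[symmetric] j by simp
    then have jB: "j \<in> B" and jM: "j \<in> medium R I"
      by simp_all
    have j_old: "j \<notin> smalls R I" "j < ?n"
      using jM by (simp_all add: medium_def smalls_def)
    \<comment> \<open>The shape clause names a minimal medium item \<open>j'\<close>; since the rest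
      of \<open>B\<close> is small, it is the item \<open>j\<close> that the algorithm compares
      with.\<close>
    obtain j' where j': "j' \<in> medium R I" "B = insert j' (smalls R I)"
      "\<forall>k\<in>medium R I. item_size (I ! j') \<le> item_size (I ! k)"
      using shape jM by blast
    moreover have "j' = j"
      using jB j_old j'(2) by blast
    ultimately have Bj: "B = insert j (smalls R I)"
      and min: "\<And>k. k \<in> medium R I \<Longrightarrow> item_size (I ! j) \<le> item_size (I ! k)"
      by simp_all
    have sub: "B' \<subseteq> B \<union> {?n}"
      by (auto simp: B')
    have "stuck R ?I B'"
    proof (rule stuckI[OF sub], rule disjI2)
      show "\<exists>j\<in>?M. B' = insert j (smalls R ?I) \<and> (\<forall>k\<in>?M. item_size (?I ! j) \<le> item_size (?I ! k))"
      proof (cases "item_size e < item_size (I ! j)")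
        case True
        then have "B' = insert ?n (smalls R I) - {j}"
          using j_old(2) unfolding B' Bj by (auto simp: nth_append)
        then have "B' = insert ?n (smalls R ?I)"
          using j_old unfolding S' by auto
        moreover have "item_size (?I ! ?n) \<le> item_size (?I ! k)" if "k \<in> ?M" for k
          using that M' True min[of k] M_item[of k] by auto
        ultimately show ?thesis
          using M' by blast
      next
        case False
        then have "B' = insert j (smalls R ?I)"
          using j_old(2) unfolding B' Bj S' by (simp add: nth_append)
        moreover have "item_size (?I ! j) \<le> item_size (?I ! k)" if "k \<in> ?M" for k
          using that M' False min[of k] M_item[of k] jM M_item[of j] by auto
        ultimately show ?thesis
          using jM M' by blast
      qed
    qed
    then show ?thesis
      using sub by simp
  next
    case False
    then obtain xs where xs: "distinct xs" "set xs = B \<union> {?n}" "B' = greedy R ?I xs"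
      using step unfolding buffer_step_def Let_def if_not_P[OF no_good_step] if_not_P[OF False]
      by blast
    \<comment> \<open>A medium item reaches the greedy case only if the buffer does not hold exactly
      one medium item. By the shape clause no medium item has arrived before.\<close>
    have alone: "medium R I = {}" if "?n \<in> ?M"
    proof (rule ccontr)
      assume "medium R I \<noteq> {}"
      then obtain j where "j \<in> medium R I" "B = insert j (smalls R I)"
        using shape by auto
      then have "B \<inter> medium R I = {j}"
        by (auto simp: medium_def smalls_def)
      then show False
        using False that M_B by simp
    qed
    have "total_size ?I (B \<union> {?n}) \<le> R"
    proof (rule stuck_total_size_le[OF R])
      show "x = y" if "x \<in> B \<union> {?n}" "y \<in> B \<union> {?n}" "x \<in> ?M" "y \<in> ?M" for x y
        using that alone M_B stuck_medium_unique[OF stuck, of x y] by blast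
    qed (use B below no_good in auto)
    then have B': "B' = B \<union> {?n}"
      unfolding xs(3) xs(2)[symmetric]
    proof (intro greedy_eq_set xs(1))
      fix i
      assume "i \<in> set xs"
      then have "i < length ?I"
        using B xs(2) by auto
      then show "0 \<le> item_size (?I ! i)"
        using proportional_inputs_size_pos[OF I] less_imp_le by blast
    qed
    have "stuck R ?I B'"
    proof (rule stuckI)
      show "B' \<subseteq> B \<union> {?n}"
        using B' by simp
      show "?M = {} \<and> B' = smalls R ?I \<or>
        (\<exists>j\<in>?M. B' = insert j (smalls R ?I) \<and> (\<forall>k\<in>?M. item_size (?I ! j) \<le> item_size (?I ! k)))"
      proof (cases "?n \<in> ?M")
        case True
        then have "?M = {?n}" "smalls R ?I = smalls R I"
          using alone new_medium by simp_all
        then show ?thesis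
          using shape alone True B' by auto
      next
        case False
        then have small: "item_size e \<le> (threshold R)\<^sup>2"
          using e_lt by (simp add: medium_def)
        then have M': "?M = medium R I" and S': "smalls R ?I = insert ?n (smalls R I)"
          by (auto simp: medium_snoc smalls_snoc)
        show ?thesis
          using shape M_item unfolding M' S' B' by (auto simp: insert_commute)
      qed
    qed
    then show ?thesis
      using B' by simp
  qed
qed

text \<open>A good buffer is itself a candidate in the next round, so the first case keeps applying.
  Until it first applies, \<open>stuck_step\<close> carries the invariant.\<close>

lemma buffer_invariant:
  assumes R: "1 \<le> R" "R \<le> 10 / 9" and A: "buffer_algorithm R A"
    and "I \<in> proportional_inputs"
  shows "A I \<subseteq> {..<length I} \<and> (good_set R I (A I) \<or> stuck R I (A I))"
  using assms(4)
proof (induction I rule: rev_induct)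
  case Nil
  \<comment> \<open>The empty buffer has size 0, which must not count as good.\<close>
  have "0 < threshold R"
    using threshold_bounds[OF R] by linarith
  then show ?case
    using A by (auto simp: buffer_algorithm_def stuck_def good_set_def smalls_def medium_def total_size_def)
next
  case (snoc e I)
  note IH = snoc.IH[OF proportional_inputs_appendD[OF snoc.prems]]
  have step: "buffer_step R (I @ [e]) (length I) (A I) (A (I @ [e]))"
    using A snoc.prems by (auto simp: buffer_algorithm_def)
  show ?case
  proof (cases "\<exists>C. C \<subseteq> A I \<union> {length I} \<and> good_set R (I @ [e]) C")
    case True
    then have "A (I @ [e]) \<subseteq> A I \<union> {length I} \<and> good_set R (I @ [e]) (A (I @ [e]))"
      using step unfolding buffer_step_def Let_def good_set_def by (simp split: if_splits)
    then show ?thesis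
      using IH by (auto simp: less_Suc_eq)
  next
    case False
    then have "\<not> good_set R (I @ [e]) (A I)"
      by blast
    then have "\<not> good_set R I (A I)"
      using IH total_size_append[of "A I" I "[e]"] by (simp add: good_set_def)
    then have "stuck R (I @ [e]) (A (I @ [e]))"
      using stuck_step[OF R snoc.prems _ step] IH False by blast
    then show ?thesis
      using stuck_subset by blast
  qed
qed

section \<open>Comparison with the optimum\<close>

text \<open>An optimal solution without medium items lies in the buffer. Otherwise its single medium
  item is exchanged for the buffered one, and its small items \<open>D\<close> are all still
  available.\<close>

lemma stuck_competitive:
  assumes R: "1 \<le> R" "R \<le> 10 / 9" and I: "I \<in> proportional_inputs" and stuck: "stuck R I B"
  shows "threshold R * OPT I \<le> knapsack_value I B"
proof -
  note r = threshold_bounds[OF R]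
  let ?r = "threshold R" and ?s = "\<lambda>i. item_size (I ! i)"
  have B: "B \<subseteq> {..<length I}"
    using stuck by (rule stuck_subset)
  then have "finite B"
    using finite_subset by blast
  have lower: "total_size I C \<le> knapsack_value I B" if "C \<subseteq> B" "total_size I C \<le> 1" for C
    using knapsack_value_ge[OF \<open>finite B\<close> that] total_value_proportional[OF I, of C] that(1) B
    by simp
  obtain C where C: "C \<subseteq> {..<length I}" "total_size I C \<le> 1" "OPT I = total_value I C"
    unfolding OPT_def using knapsack_value_attained[of "{..<length I}"] by blast
  have finC: "finite C"
    using C(1) finite_subset by blast
  have size_nonneg: "0 \<le> ?s i" if "i \<in> C" for i
    using proportional_inputs_size_pos[OF I, of i] that C(1) by auto
  have nonneg: "0 \<le> total_size I D" if "D \<subseteq> C" for D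
    unfolding total_size_def using that size_nonneg by (intro sum_nonneg) auto
  have le_self: "?r * x \<le> x" if "0 \<le> x" for x :: real
    using that r(2,3) by (simp add: mult_left_le_one_le)
  have opt: "OPT I = total_size I C"
    using C total_value_proportional[OF I] by simp
  have split: "i \<in> smalls R I \<or> i \<in> medium R I" if "i < length I" for i
    using that stuck by (auto simp: stuck_def smalls_def medium_def)
  have smalls: "smalls R I \<subseteq> B"
    using stuck by (auto simp: stuck_def)
  show ?thesis
  proof (cases "C \<inter> medium R I = {}")
    case True
    then have "C \<subseteq> B"
      using C(1) split smalls by blast
    then show ?thesis
      using lower[of C] C(2) le_self[of "total_size I C"] nonneg[of C] opt by simp
  next
    case False
    then obtain x where x: "x \<in> C" "x \<in> medium R I"
      by blast
    define D where "D = C - {x}"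
    have sum_C: "total_size I C = ?s x + total_size I D"
      unfolding D_def total_size_def using finC x(1) by (rule sum.remove)
    have "D \<inter> medium R I = {}"
    proof (rule ccontr)
      assume "D \<inter> medium R I \<noteq> {}"
      then obtain y where y: "y \<in> D" "y \<in> medium R I"
        by blast
      then have "1 < ?s x + ?s y"
        using stuck x(2) by (auto simp: stuck_def D_def)
      also have "?s y \<le> total_size I D"
        unfolding total_size_def using y(1) finC size_nonneg
        by (intro member_le_sum) (auto simp: D_def)
      finally show False
        using sum_C C(2) by simp
    qed
    then have D: "D \<subseteq> smalls R I"
      using C(1) split by (auto simp: D_def)
    obtain j where j: "j \<in> medium R I" "B = insert j (smalls R I)" "?s j \<le> ?s x"
      using stuck x(2) by (auto simp: stuck_def)
    have "j \<notin> D"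
      using D j(1) by (auto simp: smalls_def medium_def)
    then have sum_D: "total_size I (insert j D) = ?s j + total_size I D"
      using finC by (simp add: total_size_def D_def)
    have "?r * ?s x \<le> ?r\<^sup>2"
      unfolding power2_eq_square
      using x(2) r(2) by (intro mult_left_mono) (auto simp: medium_def)
    also have "\<dots> \<le> ?s j"
      using j(1) by (auto simp: medium_def)
    finally have "?r * OPT I \<le> total_size I (insert j D)"
      using le_self[of "total_size I D"] nonneg[of D] sum_C sum_D opt
      by (auto simp: D_def distrib_left)
    \<comment> \<open>The exchanged set still fits, because \<open>j\<close> is no larger than
      \<open>x\<close>.\<close>
    also have "\<dots> \<le> knapsack_value I B"
      using lower[of "insert j D"] D j sum_C sum_D C(2) by auto
    finally show ?thesis .
  qed
qed

text \<open>Values equal sizes, so the optimum is at most 1, while the buffer fits into the knapsack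
  as a whole and is worth at least r.\<close>

lemma good_set_competitive:
  assumes R: "1 \<le> R" "R \<le> 10 / 9" and I: "I \<in> proportional_inputs"
    and B: "B \<subseteq> {..<length I}" and good: "good_set R I B"
  shows "threshold R * OPT I \<le> knapsack_value I B"
proof -
  have "finite B"
    using B finite_subset by blast
  obtain C where "C \<subseteq> {..<length I}" "total_size I C \<le> 1" "OPT I = total_value I C"
    unfolding OPT_def using knapsack_value_attained[of "{..<length I}"] by blast
  then have "OPT I \<le> 1"
    using total_value_proportional[OF I] by simp
  then have "threshold R * OPT I \<le> threshold R"
    using threshold_bounds(2)[OF R] by (simp add: mult_left_le)
  also have "\<dots> \<le> knapsack_value I B"
    using knapsack_value_ge[OF \<open>finite B\<close> subset_refl, of I] good
      total_value_proportional[OF I B] by (simp add: good_set_def)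
  finally show ?thesis .
qed

section \<open>Buffer capacity and competitive ratio of the algorithm\<close>

theorem theorem11:
  fixes R :: real and A :: "item list \<Rightarrow> nat set"
  assumes "1 \<le> R" and "R \<le> 10 / 9"
    and "buffer_algorithm R A"
  shows "removable_online_algorithm proportional_inputs R A \<and>
    competitive proportional_inputs ((1 + sqrt (1 + 4 * R)) / (2 * R)) A"
proof
  note r = threshold_bounds[OF assms(1,2)]
  note inv = buffer_invariant[OF assms]
  show "removable_online_algorithm proportional_inputs R A"
    unfolding removable_online_algorithm_def
  proof (intro conjI allI impI)
    show "A [] = {}"
      using assms(3) by (simp add: buffer_algorithm_def)
    fix I e
    assume I: "I @ [e] \<in> proportional_inputs"
    have "buffer_step R (I @ [e]) (length I) (A I) (A (I @ [e]))"
      using assms(3) I by (auto simp: buffer_algorithm_def)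
    then show "A (I @ [e]) \<subseteq> A I \<union> {length I}"
      unfolding buffer_step_def Let_def using greedy_subset by (fastforce split: if_splits)
    show "total_size (I @ [e]) (A (I @ [e])) \<le> R"
    \<comment> \<open>A good buffer has size at most 1 <= R; for a stuck one the capacity bound on
      sets without a good subset applies.\<close>
    proof (cases "good_set R (I @ [e]) (A (I @ [e]))")
      case True
      then show ?thesis
        using assms(1) by (simp add: good_set_def)
    next
      case False
      then have stuck: "stuck R (I @ [e]) (A (I @ [e]))"
        using inv[OF I] by blast
      show ?thesis
        using stuck_subset[OF stuck] stuck_medium_unique[OF stuck] stuck
        by (intro stuck_total_size_le[OF assms(1,2)]) (auto simp: stuck_def)
    qed
  qed
  show "competitive proportional_inputs ((1 + sqrt (1 + 4 * R)) / (2 * R)) A"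
    unfolding competitive_def r(4) ALG_def
  proof
    fix I
    assume I: "I \<in> proportional_inputs"
    have "threshold R * OPT I \<le> knapsack_value I (A I)"
      using inv[OF I] stuck_competitive[OF assms(1,2) I] good_set_competitive[OF assms(1,2) I]
      by blast
    then show "OPT I \<le> 1 / threshold R * knapsack_value I (A I)"
      using r(2) by (simp add: field_simps)
  qed
qed

end
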